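(* Let $m,n\ge 4$, and let $K$ and $L$ be subword-free languages over a finite alphabet $\Sigma$ with $\kappa(K)=m$ and $\kappa(L)=n$. Then 1. $\kappa(K\cup L)\le mn-(m+n)$ and $\kappa(K\oplus L)\le mn-(m+n)$, and each of these bounds is tight if $|\Sigma|\ge m+n-3$; 2. $\kappa(K\cap L)\le mn-3(m+n-4)$, and the bound is tight if $|\Sigma|\ge m+n-7$; 3. $\kappa(K\setminus L)\le mn-(2m+3n-9)$, and the bound is tight if $|\Sigma|\ge m+n-6$. Moreover, the bounds cannot be met for smaller alphabets. Here "tight if $|\Sigma|\ge s$" means that for all $m,n\ge4$ and every finite non-empty alphabet $\Sigma$ with $|\Sigma|\ge s$ there exist subword-free languages $K,L$ over $\Sigma$ with $\kappa(K)=m$, $\kappa(L)=n$ attaining equality; and "cannot be met for smaller alphabets" means that if $|\Sigma|<s$ (with $s=m+n-3$ for union and for symmetric difference, $s=m+n-7$ for intersection, $s=m+n-6$ for difference), then no subword-free languages $K,L$ over $\Sigma$ with $\kappa(K)=m$, $\kappa(L)=n$ attain equality in the corresponding bound.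
   Context: For a language $L\subseteq\Sigma^*$ over a finite non-empty alphabet $\Sigma$ and a word $w\in\Sigma^*$, the (left) quotient of $L$ by $w$ is $L_w=\{x\in\Sigma^*\mid wx\in L\}$. The quotient complexity $\kappa(L)$ of a regular language $L$ is the number of distinct quotients $L_w$, $w\in\Sigma^*$; it equals the number of states of the minimal complete deterministic finite automaton accepting $L$ over $\Sigma$. $K\oplus L$ denotes symmetric difference. A word $v$ is a subword of $w$ if it is a (not necessarily contiguous) subsequence of $w$, i.e. $w=u_0v_1u_1\cdots v_ku_k$ and $v=v_1v_2\cdots v_k$ for some words $u_i,v_i\in\Sigma^*$. A language $L$ is subword-free if, whenever $u,v\in L$ and $u$ is a subword of $v$, then $u=v$. (Every subword-free language is finite, hence regular.) *)

theory Defs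
  imports "HOL-Library.Sublist"
begin

text \<open>
  The alphabet is an explicit set \<open>\<Sigma>\<close>, so that \<open>\<Sigma>\<^sup>*\<close> is \<^term>\<open>lists \<Sigma>\<close>. A word is a subword
  of another one iff the former is a \<^const>\<open>subseq\<close> of the latter.
\<close>

definition subword_free :: "'a list set \<Rightarrow> bool" where
  "subword_free L \<longleftrightarrow> (\<forall>u\<in>L. \<forall>v\<in>L. subseq u v \<longrightarrow> u = v)"

definition left_quotient :: "'a set \<Rightarrow> 'a list set \<Rightarrow> 'a list \<Rightarrow> 'a list set" where
  "left_quotient \<Sigma> L w = {x \<in> lists \<Sigma>. w @ x \<in> L}"

text \<open>
  The empty quotient counts as a quotient whenever it occurs, as for complete automata over \<open>\<Sigma>\<close>.
  The value is meaningful for regular \<open>L\<close> only: by the convention for \<^const>\<open>card\<close> it is \<open>0\<close>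
  if \<open>L\<close> has infinitely many quotients, so a positive value already forces finitely many.
\<close>

definition quotient_complexity :: "'a set \<Rightarrow> 'a list set \<Rightarrow> nat" where
  "quotient_complexity \<Sigma> L = card {left_quotient \<Sigma> L w | w. w \<in> lists \<Sigma>}"

definition subword_free_languages :: "'a set \<Rightarrow> nat \<Rightarrow> 'a list set set" where
  "subword_free_languages \<Sigma> n =
     {L. L \<subseteq> lists \<Sigma> \<and> subword_free L \<and> quotient_complexity \<Sigma> L = n}"

end

theory Submission
  imports Defs
begin

text \<open>
  Every quotient of \<open>K \<circ> L\<close> by \<open>w\<close> is \<open>K\<^sub>w \<circ> L\<^sub>w\<close>. The pairs \<open>(K, L\<^sub>w)\<close> and \<open>(K\<^sub>w, L)\<close> with
  non-empty \<open>w\<close> do not occur, and many of the other pairs give the same language because the only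
  accepting quotient is \<open>{\<epsilon>}\<close>; counting gives the upper bounds. If a bound is attained, the
  remaining pairs all occur. Let \<open>a\<close> be the first letter of a longest word of \<open>K\<close>. Only letters lead
  to \<open>s = K\<^sub>a\<close>, so the pairs with first component \<open>s\<close>, and likewise those with a similar second
  component \<open>t\<close>, need a letter each.

  For tightness, give every letter a pair of positive weights \<open>(1, j)\<close> or \<open>(i, 1)\<close>, and let \<open>K\<close> be
  the words of first weight \<open>m - 2\<close> and \<open>L\<close> those of second weight \<open>n - 2\<close>. A proper subword has
  smaller weight, so both are subword-free, and a quotient is determined by the remaining weight.
\<close>

section \<open>Quotients of subword-free languages\<close>

definition quotients :: "'a set \<Rightarrow> 'a list set \<Rightarrow> 'a list set set" where
  "quotients \<Sigma> L = left_quotient \<Sigma> L ` lists \<Sigma>"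

text \<open>In the minimal automaton these are the states other than the initial one, the accepting
  one and the sink. Combinations of these make up the bulk of every bound.\<close>

definition inner_quotients :: "'a set \<Rightarrow> 'a list set \<Rightarrow> 'a list set set" where
  "inner_quotients \<Sigma> L = quotients \<Sigma> L - {L, {[]}, {}}"

lemma quotient_complexity_eq_card: "quotient_complexity \<Sigma> L = card (quotients \<Sigma> L)"
  unfolding quotient_complexity_def quotients_def by (simp add: Setcompr_eq_image)

lemma left_quotient_Nil: "L \<subseteq> lists \<Sigma> \<Longrightarrow> left_quotient \<Sigma> L [] = L"
  by (auto simp: left_quotient_def)

lemma left_quotient_of_member:
  assumes "subword_free L" "w \<in> L"
  shows "left_quotient \<Sigma> L w = {[]}"
proof -
  have "x = []" if "w @ x \<in> L" for x
  proof -
    have "subseq w (w @ x)"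
      by (rule list_emb_prefix) simp
    then have "w = w @ x"
      using assms that unfolding subword_free_def by blast
    then show ?thesis by simp
  qed
  then show ?thesis
    using assms(2) by (auto simp: left_quotient_def)
qed

text \<open>A common element \<open>x\<close> would make \<open>w @ x\<close> a proper subword of
  \<open>w @ v @ x\<close> inside \<open>L\<close>. So the only cycles in the minimal automaton are
  loops at the empty quotient.\<close>

lemma left_quotient_append_neq:
  assumes "subword_free L" "left_quotient \<Sigma> L (w @ v) \<noteq> {}" "v \<noteq> []"
  shows "left_quotient \<Sigma> L (w @ v) \<noteq> left_quotient \<Sigma> L w"
proof
  assume eq: "left_quotient \<Sigma> L (w @ v) = left_quotient \<Sigma> L w"
  then obtain x where "x \<in> left_quotient \<Sigma> L (w @ v)" "x \<in> left_quotient \<Sigma> L w"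
    using assms(2) by auto
  then have "w @ v @ x \<in> L" "w @ x \<in> L"
    by (auto simp: left_quotient_def)
  moreover have "subseq (w @ x) (w @ v @ x)"
    by (simp add: subseq_append' subseq_drop_many)
  ultimately have "w @ x = w @ v @ x"
    using assms(1) unfolding subword_free_def by blast
  with assms(3) show False by simp
qed

section \<open>Languages with at least four quotients\<close>

context
  fixes \<Sigma> :: "'a set" and L :: "'a list set" and n :: nat
  assumes L: "L \<in> subword_free_languages \<Sigma> n" and n: "n \<ge> 4"
begin

lemma subword_free_languagesD:
  shows "L \<subseteq> lists \<Sigma>" "subword_free L" "card (quotients \<Sigma> L) = n" "finite (quotients \<Sigma> L)"
  using L n card_ge_0_finite[of "quotients \<Sigma> L"]
  by (auto simp: subword_free_languages_def quotient_complexity_eq_card)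

lemma left_quotient_neq_self:
  assumes "w \<noteq> []" "L \<noteq> {}"
  shows "left_quotient \<Sigma> L w \<noteq> L"
  using left_quotient_append_neq[of L \<Sigma> "[]" w] subword_free_languagesD assms
  by (auto simp: left_quotient_Nil)

text \<open>This is how \<open>n \<ge> 4\<close> rules out degenerate languages. The three sets may
  coincide, so shorter lists are covered too.\<close>

lemma not_few_quotients: "\<not> quotients \<Sigma> L \<subseteq> {X, Y, Z}"
proof
  assume "quotients \<Sigma> L \<subseteq> {X, Y, Z}"
  then have "n \<le> card {X, Y, Z}"
    using subword_free_languagesD card_mono by (metis finite.emptyI finite.insertI)
  also have "\<dots> \<le> 3"
    by (simp add: card_insert_if)
  finally show False using n by simp
qed

lemma language_nontrivial: "L \<noteq> {}" "[] \<notin> L"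
proof -
  show "L \<noteq> {}"
  proof
    assume "L = {}"
    then have "quotients \<Sigma> L \<subseteq> {{}, {}, {}}"
      by (auto simp: quotients_def left_quotient_def)
    then show False using not_few_quotients by blast
  qed
  show "[] \<notin> L"
  proof
    assume "[] \<in> L"
    then have "L = {[]}"
      using left_quotient_of_member[of L "[]"] left_quotient_Nil[of L \<Sigma>] subword_free_languagesD by metis
    then have "quotients \<Sigma> L \<subseteq> {{[]}, {}, {}}"
      by (auto simp: quotients_def left_quotient_def)
    then show False using not_few_quotients by blast
  qed
qed

lemma quotients_members: "L \<in> quotients \<Sigma> L" "{[]} \<in> quotients \<Sigma> L" "{} \<in> quotients \<Sigma> L"
proof -
  note D = subword_free_languagesD
  show "L \<in> quotients \<Sigma> L"
    unfolding quotients_def using left_quotient_Nil[of L \<Sigma>] D by (metis image_eqI lists.Nil)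
  obtain w where w: "w \<in> L"
    using language_nontrivial by auto
  then have "w \<in> lists \<Sigma>" and wne: "w \<noteq> []"
    using D language_nontrivial by auto
  then show "{[]} \<in> quotients \<Sigma> L"
    unfolding quotients_def using left_quotient_of_member[of L w \<Sigma>] D w by (metis image_eqI)
  \<comment> \<open>Nothing but the empty word may follow a member of \<open>L\<close>, so reading
    the non-empty \<open>w\<close> once more leads to the sink.\<close>
  have "left_quotient \<Sigma> L (w @ w) = {}"
  proof (rule ccontr)
    assume "left_quotient \<Sigma> L (w @ w) \<noteq> {}"
    then have "w @ x \<in> left_quotient \<Sigma> L w" if "x \<in> left_quotient \<Sigma> L (w @ w)" for x
      using that \<open>w \<in> lists \<Sigma>\<close> by (auto simp: left_quotient_def)
    then show False
      using left_quotient_of_member[of L w \<Sigma>] D w wne \<open>left_quotient \<Sigma> L (w @ w) \<noteq> {}\<close> by blast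
  qed
  then show "{} \<in> quotients \<Sigma> L"
    unfolding quotients_def using \<open>w \<in> lists \<Sigma>\<close> by (metis image_eqI append_in_lists_conv)
qed

lemma card_quotients:
  shows "card (quotients \<Sigma> L - {L}) = n - 1" "card (quotients \<Sigma> L - {L, {[]}}) = n - 2"
    "card (inner_quotients \<Sigma> L) = n - 3"
proof -
  have "L \<noteq> {[]}"
    using language_nontrivial by auto
  then show "card (quotients \<Sigma> L - {L}) = n - 1" "card (quotients \<Sigma> L - {L, {[]}}) = n - 2"
    "card (inner_quotients \<Sigma> L) = n - 3"
    using quotients_members language_nontrivial(1) subword_free_languagesD
    by (simp_all add: inner_quotients_def card_Diff_subset)
qed

lemma left_quotient_nonempty_word_cases:
  assumes "w \<in> lists \<Sigma>" "w \<noteq> []"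
  obtains "left_quotient \<Sigma> L w \<in> inner_quotients \<Sigma> L"
  | "left_quotient \<Sigma> L w = {[]}" | "left_quotient \<Sigma> L w = {}"
proof -
  have "left_quotient \<Sigma> L w \<in> quotients \<Sigma> L - {L}"
    using assms left_quotient_neq_self[of w] language_nontrivial(1) by (simp add: quotients_def)
  then show ?thesis
    using that unfolding inner_quotients_def by blast
qed

lemma Nil_notin_inner_quotients: "X \<in> inner_quotients \<Sigma> L \<Longrightarrow> [] \<notin> X"
proof
  assume "X \<in> inner_quotients \<Sigma> L" "[] \<in> X"
  then obtain w where w: "X = left_quotient \<Sigma> L w" "X \<noteq> {[]}"
    unfolding inner_quotients_def quotients_def by blast
  with \<open>[] \<in> X\<close> have "w \<in> L"
    by (simp add: left_quotient_def)
  then show False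
    using left_quotient_of_member[of L w \<Sigma>] subword_free_languagesD w by simp
qed

text \<open>The \<open>length w + 1\<close> prefixes of \<open>w\<close> have non-empty quotients,
  which are pairwise distinct because the automaton has no cycle through them. This bound guarantees
  that a longest word exists.\<close>

lemma length_less_if_mem:
  assumes "w \<in> L"
  shows "length w < n"
proof -
  have w: "w \<in> lists \<Sigma>" using assms subword_free_languagesD by auto
  have neq: "left_quotient \<Sigma> L (take j w) \<noteq> left_quotient \<Sigma> L (take i w)"
    if "i < j" "j \<le> length w" for i j
  proof -
    have j: "take j w = take i w @ drop i (take j w)"
      using that by (metis append_take_drop_id min.absorb1 less_imp_le take_take)
    have "drop j w \<in> left_quotient \<Sigma> L (take j w)"
      using assms w by (auto simp: left_quotient_def dest: in_set_dropD)
    then show ?thesis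
      using left_quotient_append_neq[of L \<Sigma> "take i w" "drop i (take j w)"] j that
        subword_free_languagesD by auto
  qed
  have "inj_on (\<lambda>i. left_quotient \<Sigma> L (take i w)) {..length w}"
    by (rule inj_onI) (metis neq atMost_iff linorder_neqE_nat)
  moreover have "(\<lambda>i. left_quotient \<Sigma> L (take i w)) ` {..length w} \<subseteq> quotients \<Sigma> L"
    using w by (auto simp: quotients_def dest: in_set_takeD)
  ultimately have "card {..length w} \<le> n"
    using card_inj_on_le subword_free_languagesD by metis
  then show ?thesis by simp
qed

text \<open>Such a quotient is \<open>L\<^sub>a\<close>, where \<open>a\<close> is the first letter of a longest word of \<open>L\<close>.\<close>
lemma inner_quotient_reached_by_letters_only:
  obtains s where "s \<in> inner_quotients \<Sigma> L"
    "\<And>w. w \<in> lists \<Sigma> \<Longrightarrow> left_quotient \<Sigma> L w = s \<Longrightarrow> length w = 1"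
proof -
  note D = subword_free_languagesD
  obtain v where v: "v \<in> L" and max: "\<And>x. x \<in> L \<Longrightarrow> length x \<le> length v"
    using ex_has_greatest_nat[of "\<lambda>x. x \<in> L" _ length n] length_less_if_mem language_nontrivial
    by (metis equals0I less_imp_le)
  obtain a u where au: "v = a # u"
    using v language_nontrivial by (cases v) auto
  have inl: "a \<in> \<Sigma>" "u \<in> lists \<Sigma>"
    using v au D by auto
  define s where "s = left_quotient \<Sigma> L [a]"
  have us: "u \<in> s"
    using v au inl by (simp add: s_def left_quotient_def)
  \<comment> \<open>Otherwise all words of \<open>L\<close> have length at most 1, which leaves at
    most three quotients.\<close>
  have "u \<noteq> []"
  proof
    assume "u = []"
    then have *: "length x \<le> 1" if "x \<in> L" for x
      using max au that by force
    have short: "left_quotient \<Sigma> L w \<subseteq> {[]}" if "w \<noteq> []" for w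
    proof
      fix x assume "x \<in> left_quotient \<Sigma> L w"
      then have "length (w @ x) \<le> 1"
        using * by (auto simp: left_quotient_def simp del: length_append)
      with that show "x \<in> {[]}"
        by (cases w) auto
    qed
    have "quotients \<Sigma> L \<subseteq> {L, {[]}, {}}"
    proof
      fix X assume "X \<in> quotients \<Sigma> L"
      then obtain w where "X = left_quotient \<Sigma> L w"
        by (auto simp: quotients_def)
      then show "X \<in> {L, {[]}, {}}"
        using short[of w] left_quotient_Nil[OF D(1)] by (cases "w = []") auto
    qed
    then show False using not_few_quotients by blast
  qed
  then have "s \<noteq> {[]}" "s \<noteq> {}"
    using us by auto
  moreover have "s \<in> quotients \<Sigma> L"
    using inl by (auto simp: s_def quotients_def)
  moreover have "s \<noteq> L"
    using left_quotient_neq_self[of "[a]"] language_nontrivial by (simp add: s_def)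
  ultimately have "s \<in> inner_quotients \<Sigma> L"
    by (simp add: inner_quotients_def)
  \<comment> \<open>Any \<open>w\<close> that leads to \<open>s\<close> can be continued by
    \<open>u\<close> to a member of \<open>L\<close>; the maximal length of \<open>a # u\<close>
    then forbids a second letter.\<close>
  moreover have "length w = 1" if "w \<in> lists \<Sigma>" "left_quotient \<Sigma> L w = s" for w
  proof -
    have "w @ u \<in> L"
      using us that by (auto simp: left_quotient_def)
    then have "length w \<le> 1"
      using max au by force
    moreover have "w \<noteq> []"
      using that \<open>s \<noteq> L\<close> left_quotient_Nil[OF D(1)] by auto
    ultimately show ?thesis
      by (cases w) auto
  qed
  ultimately show ?thesis
    using that by blast
qed

end

section \<open>Upper bounds and necessary alphabet sizes\<close>

lemma left_quotient_boolean:
  "left_quotient \<Sigma> (K \<union> L) w = left_quotient \<Sigma> K w \<union> left_quotient \<Sigma> L w"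
  "left_quotient \<Sigma> (K \<inter> L) w = left_quotient \<Sigma> K w \<inter> left_quotient \<Sigma> L w"
  "left_quotient \<Sigma> (K - L) w = left_quotient \<Sigma> K w - left_quotient \<Sigma> L w"
  by (auto simp: left_quotient_def)

text \<open>
  \<open>R\<close> collects the pairs of quotients whose combination may be a new quotient; \<open>r\<close> chooses a
  representative among quotients of \<open>L\<close> that give the same combinations. If the bound is attained,
  then each pair in \<open>R\<close> is reached, and the pairs in a suitable row and column of \<open>R\<close> are reached
  by letters only.
\<close>
lemma boolean_operation_bound:
  fixes f :: "'a list set \<Rightarrow> 'a list set \<Rightarrow> 'a list set" and r :: "'a list set \<Rightarrow> 'a list set"
  assumes K: "K \<in> subword_free_languages \<Sigma> m" and m: "m \<ge> 4"
    and L: "L \<in> subword_free_languages \<Sigma> n" and n: "n \<ge> 4"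
    and fin: "finite \<Sigma>"
    and r: "\<And>w. r (left_quotient \<Sigma> L w) \<in> inner_quotients \<Sigma> L
      \<Longrightarrow> r (left_quotient \<Sigma> L w) = left_quotient \<Sigma> L w"
    and finR: "finite R"
    and R: "\<And>w. \<lbrakk>w \<in> lists \<Sigma>; w \<noteq> []; left_quotient \<Sigma> M w \<notin> {{[]}, {}}\<rbrakk>
      \<Longrightarrow> (left_quotient \<Sigma> K w, r (left_quotient \<Sigma> L w)) \<in> R \<and>
        left_quotient \<Sigma> M w = f (left_quotient \<Sigma> K w) (r (left_quotient \<Sigma> L w))"
    and row: "inner_quotients \<Sigma> K \<times> B \<subseteq> R"
    and col: "A \<times> inner_quotients \<Sigma> L \<subseteq> R" "inner_quotients \<Sigma> K \<subseteq> A"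
  shows "quotient_complexity \<Sigma> M \<le> card R + 3"
    and "quotient_complexity \<Sigma> M = card R + 3 \<Longrightarrow> card A + card B \<le> card \<Sigma> + 1"
proof -
  define g where "g w = (left_quotient \<Sigma> K w, r (left_quotient \<Sigma> L w))" for w
  define R' where "R' = R \<inter> g ` lists \<Sigma>"
  let ?F = "{left_quotient \<Sigma> M [], {[]}, {}}"
  have finR': "finite R'" and R'R: "card R' \<le> card R"
    using finR by (auto simp: R'_def intro: card_mono)
  \<comment> \<open>The summand 3 of the bound comes from \<open>?F\<close>; every other quotient
    comes from a pair in \<open>R\<close> that is actually reached.\<close>
  have "quotients \<Sigma> M \<subseteq> ?F \<union> case_prod f ` R'"
  proof
    fix X assume "X \<in> quotients \<Sigma> M"
    then obtain w where w: "w \<in> lists \<Sigma>" "X = left_quotient \<Sigma> M w"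
      by (auto simp: quotients_def)
    show "X \<in> ?F \<union> case_prod f ` R'"
    proof (cases "w = [] \<or> X \<in> {{[]}, {}}")
      case True
      then show ?thesis using w by auto
    next
      case False
      then have "g w \<in> R'" "X = case_prod f (g w)"
        using R[of w] w by (auto simp: R'_def g_def)
      then show ?thesis by blast
    qed
  qed
  then have "card (quotients \<Sigma> M) \<le> card (?F \<union> case_prod f ` R')"
    using finR' by (intro card_mono) auto
  also have "\<dots> \<le> card ?F + card (case_prod f ` R')"
    by (rule card_Un_le)
  also have "\<dots> \<le> 3 + card R'"
    using card_image_le[OF finR', of "case_prod f"] by (intro add_mono) (simp_all add: card_insert_if)
  finally have le: "quotient_complexity \<Sigma> M \<le> 3 + card R'"
    by (simp add: quotient_complexity_eq_card)
  then show "quotient_complexity \<Sigma> M \<le> card R + 3"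
    using R'R by simp
  assume "quotient_complexity \<Sigma> M = card R + 3"
  with le R'R have "card R' = card R" by simp
  then have "R' = R"
    using finR card_subset_eq[of R R'] by (auto simp: R'_def)
  then have reach: "R \<subseteq> g ` lists \<Sigma>"
    by (auto simp: R'_def)
  obtain s where s: "s \<in> inner_quotients \<Sigma> K"
    "\<And>w. w \<in> lists \<Sigma> \<Longrightarrow> left_quotient \<Sigma> K w = s \<Longrightarrow> length w = 1"
    using inner_quotient_reached_by_letters_only[OF K m] by blast
  obtain t where t: "t \<in> inner_quotients \<Sigma> L"
    "\<And>w. w \<in> lists \<Sigma> \<Longrightarrow> left_quotient \<Sigma> L w = t \<Longrightarrow> length w = 1"
    using inner_quotient_reached_by_letters_only[OF L n] by blast
  \<comment> \<open>This is the row of \<open>s\<close> and the column of \<open>t\<close>, with the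
    row's entry left out of the column to avoid double counting. In the column, \<open>r\<close>
    only yields a representative; its hypothesis turns
    \<open>r (left_quotient \<Sigma> L w) = t\<close> into a statement about the quotient
    itself.\<close>
  have sub: "{s} \<times> B \<union> (A - {s}) \<times> {t} \<subseteq> (\<lambda>a. g [a]) ` \<Sigma>"
  proof
    fix p assume p: "p \<in> {s} \<times> B \<union> (A - {s}) \<times> {t}"
    then have "p \<in> R"
      using row col(1) s(1) t(1) by blast
    then obtain w where w: "w \<in> lists \<Sigma>" "p = g w"
      using reach by blast
    have "length w = 1"
    proof (cases "fst p = s")
      case True
      then show ?thesis using s(2) w by (simp add: g_def)
    next
      case False
      then have "r (left_quotient \<Sigma> L w) = t"
        using p w by (auto simp: g_def)
      then show ?thesis using r[of w] t w by simp
    qed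
    then obtain a where "w = [a]"
      by (auto simp: length_Suc_conv)
    with w show "p \<in> (\<lambda>a. g [a]) ` \<Sigma>" by auto
  qed
  have finAB: "finite A" "finite B"
    using finite_subset[OF row finR] finite_subset[OF col(1) finR] s(1) t(1)
    by (auto simp: finite_cartesian_product_iff)
  have "card ({s} \<times> B \<union> (A - {s}) \<times> {t}) = card B + (card A - 1)"
    using finAB s(1) col(2) by (subst card_Un_disjoint) (auto simp: card_cartesian_product)
  moreover have "card ({s} \<times> B \<union> (A - {s}) \<times> {t}) \<le> card \<Sigma>"
    using surj_card_le[OF fin sub] .
  moreover have "card A \<ge> 1"
    using finAB s(1) col(2) by (metis One_nat_def Suc_leI card_gt_0_iff empty_iff in_mono)
  ultimately show "card A + card B \<le> card \<Sigma> + 1" by simp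
qed

section \<open>Bounds for the individual operations\<close>

context
  fixes \<Sigma> :: "'a set" and K L :: "'a list set" and m n :: nat
  assumes K: "K \<in> subword_free_languages \<Sigma> m" and m: "m \<ge> 4"
    and L: "L \<in> subword_free_languages \<Sigma> n" and n: "n \<ge> 4"
    and fin: "finite \<Sigma>"
begin

text \<open>Union and symmetric difference are treated together. After a non-empty word neither
  component is initial, and the four pairs of trivial components yield only trivial quotients, so (m
  - 1)(n - 1) - 4 pairs remain. The row and column run through all non-initial quotients.\<close>

lemma union_like_bound:
  assumes f: "\<And>w. left_quotient \<Sigma> (f K L) w = f (left_quotient \<Sigma> K w) (left_quotient \<Sigma> L w)"
    and triv: "\<And>X Y. X \<in> {{[]}, {}} \<Longrightarrow> Y \<in> {{[]}, {}} \<Longrightarrow> f X Y \<in> {{[]}, {}}"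
  shows "quotient_complexity \<Sigma> (f K L) \<le> m * n - (m + n)"
    and "quotient_complexity \<Sigma> (f K L) = m * n - (m + n) \<Longrightarrow> m + n - 3 \<le> card \<Sigma>"
proof -
  let ?A = "quotients \<Sigma> K - {K}" and ?B = "quotients \<Sigma> L - {L}"
  let ?T = "{{[]}, {}} :: 'a list set set"
  let ?R = "?A \<times> ?B - ?T \<times> ?T"
  note fins = subword_free_languagesD(4)[OF K m] subword_free_languagesD(4)[OF L n]
  have "?T \<subseteq> ?A" "?T \<subseteq> ?B"
    using quotients_members[OF K m] quotients_members[OF L n]
      language_nontrivial[OF K m] language_nontrivial[OF L n] by auto
  then have "card ?R = card (?A \<times> ?B) - card (?T \<times> ?T)"
    by (intro card_Diff_subset) auto
  also have "\<dots> = (m - 1) * (n - 1) - 4"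
    using card_quotients(1)[OF K m] card_quotients(1)[OF L n] by (simp add: card_cartesian_product)
  finally have "card ?R = (m - 1) * (n - 1) - 4" .
  moreover have "m * n - (m + n) = (m - 1) * (n - 1) - 4 + 3"
  proof -
    \<comment> \<open>Shifting the variables by 4 removes the truncated subtractions.\<close>
    obtain a b where "m = a + 4" "n = b + 4"
      using m n by (metis add.commute le_Suc_ex)
    then show ?thesis by (simp add: algebra_simps)
  qed
  ultimately have card: "m * n - (m + n) = card ?R + 3" by simp
  have R: "(left_quotient \<Sigma> K w, left_quotient \<Sigma> L w) \<in> ?R \<and>
      left_quotient \<Sigma> (f K L) w = f (left_quotient \<Sigma> K w) (left_quotient \<Sigma> L w)"
    if "w \<in> lists \<Sigma>" "w \<noteq> []" "left_quotient \<Sigma> (f K L) w \<notin> ?T" for w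
    using that triv[of "left_quotient \<Sigma> K w" "left_quotient \<Sigma> L w"]
      left_quotient_neq_self[OF K m, of w] left_quotient_neq_self[OF L n, of w]
      language_nontrivial[OF K m] language_nontrivial[OF L n]
    by (auto simp: quotients_def f)
  have incl: "inner_quotients \<Sigma> K \<times> ?B \<subseteq> ?R" "?A \<times> inner_quotients \<Sigma> L \<subseteq> ?R" "inner_quotients \<Sigma> K \<subseteq> ?A"
    by (auto simp: inner_quotients_def)
  have finR: "finite ?R" using fins by auto
  note bound = boolean_operation_bound[where f = f and r = "\<lambda>Y. Y", OF K m L n fin refl finR R incl]
  show "quotient_complexity \<Sigma> (f K L) \<le> m * n - (m + n)"
    using bound(1) card by simp
  show "m + n - 3 \<le> card \<Sigma>" if "quotient_complexity \<Sigma> (f K L) = m * n - (m + n)"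
    using bound(2) card card_quotients(1)[OF K m] card_quotients(1)[OF L n] that m n by simp
qed

text \<open>Intersecting with \<open>{[]}\<close> or \<open>{}\<close> gives a trivial quotient, so
  only pairs of inner quotients count.\<close>

lemma intersection_bound:
  shows "quotient_complexity \<Sigma> (K \<inter> L) \<le> m * n - 3 * (m + n - 4)"
    and "quotient_complexity \<Sigma> (K \<inter> L) = m * n - 3 * (m + n - 4) \<Longrightarrow> m + n - 7 \<le> card \<Sigma>"
proof -
  let ?A = "inner_quotients \<Sigma> K" and ?B = "inner_quotients \<Sigma> L"
  let ?R = "?A \<times> ?B"
  note fins = subword_free_languagesD(4)[OF K m] subword_free_languagesD(4)[OF L n]
  have "card ?R = (m - 3) * (n - 3)"
    using card_quotients(3)[OF K m] card_quotients(3)[OF L n] by (simp add: card_cartesian_product)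
  moreover have "m * n - 3 * (m + n - 4) = (m - 3) * (n - 3) + 3"
  proof -
    obtain a b where "m = a + 4" "n = b + 4"
      using m n by (metis add.commute le_Suc_ex)
    then show ?thesis by (simp add: algebra_simps)
  qed
  ultimately have card: "m * n - 3 * (m + n - 4) = card ?R + 3" by simp
  have R: "(left_quotient \<Sigma> K w, left_quotient \<Sigma> L w) \<in> ?R \<and>
      left_quotient \<Sigma> (K \<inter> L) w = left_quotient \<Sigma> K w \<inter> left_quotient \<Sigma> L w"
    if "w \<in> lists \<Sigma>" "w \<noteq> []" "left_quotient \<Sigma> (K \<inter> L) w \<notin> {{[]}, {}}" for w
    by (rule left_quotient_nonempty_word_cases[OF K m that(1,2)];
        rule left_quotient_nonempty_word_cases[OF L n that(1,2)]; use that(3) in \<open>auto simp: left_quotient_boolean\<close>)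
  have finR: "finite ?R" using fins by (simp add: inner_quotients_def)
  note bound = boolean_operation_bound[where f = "(\<inter>)" and r = "\<lambda>Y. Y",
      OF K m L n fin refl finR R order.refl order.refl order.refl]
  show "quotient_complexity \<Sigma> (K \<inter> L) \<le> m * n - 3 * (m + n - 4)"
    using bound(1) card by simp
  show "m + n - 7 \<le> card \<Sigma>" if "quotient_complexity \<Sigma> (K \<inter> L) = m * n - 3 * (m + n - 4)"
    using bound(2) card card_quotients(3)[OF K m] card_quotients(3)[OF L n] that m n by simp
qed

text \<open>The first component must be inner. Such a quotient lacks the empty word, so subtracting
  \<open>{[]}\<close> or \<open>{}\<close> from it has the same effect, and one of these two second
  components suffices.\<close>

lemma difference_bound:
  shows "quotient_complexity \<Sigma> (K - L) \<le> m * n - (2 * m + 3 * n - 9)"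
    and "quotient_complexity \<Sigma> (K - L) = m * n - (2 * m + 3 * n - 9) \<Longrightarrow> m + n - 6 \<le> card \<Sigma>"
proof -
  let ?A = "inner_quotients \<Sigma> K" and ?B = "quotients \<Sigma> L - {L, {[]}}"
  let ?R = "?A \<times> ?B"
  note fins = subword_free_languagesD(4)[OF K m] subword_free_languagesD(4)[OF L n]
  have "card ?R = (m - 3) * (n - 2)"
    using card_quotients(3)[OF K m] card_quotients(2)[OF L n] by (simp add: card_cartesian_product)
  moreover have "m * n - (2 * m + 3 * n - 9) = (m - 3) * (n - 2) + 3"
  proof -
    obtain a b where "m = a + 4" "n = b + 4"
      using m n by (metis add.commute le_Suc_ex)
    then show ?thesis by (simp add: algebra_simps)
  qed
  ultimately have card: "m * n - (2 * m + 3 * n - 9) = card ?R + 3" by simp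
  \<comment> \<open>This map sends \<open>{[]}\<close> to \<open>{}\<close> and fixes all other
    quotients of \<open>L\<close>, none of which contains the empty word.\<close>
  let ?r = "\<lambda>Y :: 'a list set. Y - {[]}"
  have r: "?r (left_quotient \<Sigma> L w) = left_quotient \<Sigma> L w"
    if "?r (left_quotient \<Sigma> L w) \<in> inner_quotients \<Sigma> L" for w
  proof -
    have "left_quotient \<Sigma> L w \<noteq> {[]}"
      using that by (auto simp: inner_quotients_def)
    then have "[] \<notin> left_quotient \<Sigma> L w"
      using left_quotient_of_member[of L w \<Sigma>] subword_free_languagesD[OF L n]
      by (auto simp: left_quotient_def)
    then show ?thesis by simp
  qed
  have R: "(left_quotient \<Sigma> K w, ?r (left_quotient \<Sigma> L w)) \<in> ?R \<and>
      left_quotient \<Sigma> (K - L) w = left_quotient \<Sigma> K w - ?r (left_quotient \<Sigma> L w)"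
    if w: "w \<in> lists \<Sigma>" "w \<noteq> []" "left_quotient \<Sigma> (K - L) w \<notin> {{[]}, {}}" for w
  proof -
    have "left_quotient \<Sigma> K w \<in> ?A"
      by (rule left_quotient_nonempty_word_cases[OF K m w(1,2)])
        (use w(3) in \<open>auto simp: left_quotient_boolean\<close>)
    moreover have "?r (left_quotient \<Sigma> L w) \<in> ?B"
      by (rule left_quotient_nonempty_word_cases[OF L n w(1,2)])
        (use quotients_members[OF L n] language_nontrivial[OF L n] Nil_notin_inner_quotients[OF L n]
          in \<open>auto simp: inner_quotients_def\<close>)
    ultimately show ?thesis
      using Nil_notin_inner_quotients[OF K m] by (auto simp: left_quotient_boolean)
  qed
  have incl: "?A \<times> inner_quotients \<Sigma> L \<subseteq> ?R"
    by (auto simp: inner_quotients_def)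
  have finR: "finite ?R" using fins by (simp add: inner_quotients_def)
  note bound = boolean_operation_bound[where f = "(-)" and r = ?r,
      OF K m L n fin r finR R order.refl incl order.refl]
  show "quotient_complexity \<Sigma> (K - L) \<le> m * n - (2 * m + 3 * n - 9)"
    using bound(1) card by simp
  show "m + n - 6 \<le> card \<Sigma>"
    if "quotient_complexity \<Sigma> (K - L) = m * n - (2 * m + 3 * n - 9)"
    using bound(2) card card_quotients(3)[OF K m] card_quotients(2)[OF L n] that m n by simp
qed

end

section \<open>Languages of words of prescribed weight\<close>

definition weight :: "('a \<Rightarrow> nat) \<Rightarrow> 'a list \<Rightarrow> nat" where
  "weight f w = sum_list (map f w)"

definition weight_language :: "'a set \<Rightarrow> ('a \<Rightarrow> nat) \<Rightarrow> nat \<Rightarrow> 'a list set" where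
  "weight_language \<Sigma> f N = {w \<in> lists \<Sigma>. weight f w = N}"

lemma weight_simps [simp]:
  "weight f [] = 0" "weight f (a # w) = f a + weight f w" "weight f (v @ w) = weight f v + weight f w"
  "weight f (replicate k a) = k * f a"
  by (simp_all add: weight_def sum_list_replicate)

lemma subseq_weight_less:
  assumes "subseq u v" "\<And>a. a \<in> set v \<Longrightarrow> f a > 0"
  shows "u = v \<or> weight f u < weight f v"
  using assms
proof (induction rule: list_emb.induct)
  case (list_emb_Nil ys)
  then show ?case by (cases ys) auto
next
  case (list_emb_Cons xs ys y)
  then have "f y > 0" "xs = ys \<or> weight f xs < weight f ys" by auto
  then show ?case by auto
next
  case (list_emb_Cons2 x y xs ys)
  then have "xs = ys \<or> weight f xs < weight f ys" by auto
  then show ?case using list_emb_Cons2 by auto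
qed

lemma left_quotient_weight_language:
  assumes "w \<in> lists \<Sigma>"
  shows "left_quotient \<Sigma> (weight_language \<Sigma> f N) w = {v \<in> lists \<Sigma>. weight f v + weight f w = N}"
  using assms by (auto simp: left_quotient_def weight_language_def)

text \<open>A quotient depends only on the weight already read. The values 0 to \<open>N\<close> are
  distinguishable and all larger ones give the sink, hence \<open>N + 2\<close> quotients; powers of
  the letter of weight 1 reach them all.\<close>

lemma weight_language_subword_free_languages:
  assumes pos: "\<And>a. a \<in> \<Sigma> \<Longrightarrow> f a > 0" and a: "a \<in> \<Sigma>" "f a = 1"
  shows "weight_language \<Sigma> f N \<in> subword_free_languages \<Sigma> (N + 2)"
proof -
  let ?L = "weight_language \<Sigma> f N"
  define T where "T i = {v \<in> lists \<Sigma>. weight f v + i = N}" for i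
  have rep: "replicate k a \<in> lists \<Sigma>" "weight f (replicate k a) = k" for k
    using a by auto
  have "subword_free ?L"
    unfolding subword_free_def weight_language_def
  proof (intro ballI impI)
    fix u v assume "u \<in> {w \<in> lists \<Sigma>. weight f w = N}" "v \<in> {w \<in> lists \<Sigma>. weight f w = N}" "subseq u v"
    then show "u = v"
      using subseq_weight_less[of u v f] pos by fastforce
  qed
  moreover have "quotients \<Sigma> ?L = T ` {..N + 1}"
  proof
    show "quotients \<Sigma> ?L \<subseteq> T ` {..N + 1}"
    proof
      fix X assume "X \<in> quotients \<Sigma> ?L"
      then obtain w where "w \<in> lists \<Sigma>" "X = T (weight f w)"
        by (auto simp: quotients_def left_quotient_weight_language T_def)
      \<comment> \<open>Every weight above \<open>N\<close> is represented by \<open>N + 1\<close>,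
        where \<open>T\<close> is empty.\<close>
      moreover have "T (weight f w) = T (min (weight f w) (N + 1))"
        by (auto simp: T_def min_def)
      ultimately show "X \<in> T ` {..N + 1}" by auto
    qed
    have "T i = left_quotient \<Sigma> ?L (replicate i a)" for i
      using rep(1)[of i] a(2) by (simp add: left_quotient_weight_language T_def)
    then show "T ` {..N + 1} \<subseteq> quotients \<Sigma> ?L"
      using rep by (auto simp: quotients_def)
  qed
  moreover have "inj_on T {..N + 1}"
  proof (rule linorder_inj_onI)
    fix i j assume "i < j" "i \<in> {..N + 1}" "j \<in> {..N + 1}"
    then have "replicate (N - i) a \<in> T i" "replicate (N - i) a \<notin> T j"
      using rep(1)[of "N - i"] a(2) by (auto simp: T_def)
    then show "T i \<noteq> T j" by auto
  qed auto
  ultimately show ?thesis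
    by (auto simp: subword_free_languages_def quotient_complexity_eq_card card_image weight_language_def)
qed

text \<open>This is the submonoid of pairs of naturals generated by the weight pairs of the letters.
  It records which pairs of quotients some word reaches, and also which test words exist for telling
  quotients apart.\<close>

definition weight_pairs :: "'a set \<Rightarrow> ('a \<Rightarrow> nat) \<Rightarrow> ('a \<Rightarrow> nat) \<Rightarrow> (nat \<times> nat) set" where
  "weight_pairs \<Sigma> x y = (\<lambda>w. (weight x w, weight y w)) ` lists \<Sigma>"

lemma weight_pairs_zero: "(0, 0) \<in> weight_pairs \<Sigma> x y"
  unfolding weight_pairs_def by (intro image_eqI[of _ _ "[]"]) auto

lemma weight_pairs_letter: "a \<in> \<Sigma> \<Longrightarrow> (x a, y a) \<in> weight_pairs \<Sigma> x y"
  unfolding weight_pairs_def by (intro image_eqI[of _ _ "[a]"]) auto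

lemma weight_pairs_add:
  assumes "(i, j) \<in> weight_pairs \<Sigma> x y" "(i', j') \<in> weight_pairs \<Sigma> x y"
  shows "(i + i', j + j') \<in> weight_pairs \<Sigma> x y"
proof -
  obtain v w where "v \<in> lists \<Sigma>" "w \<in> lists \<Sigma>" "i = weight x v" "j = weight y v"
    "i' = weight x w" "j' = weight y w"
    using assms by (auto simp: weight_pairs_def)
  then show ?thesis
    unfolding weight_pairs_def by (intro image_eqI[of _ _ "v @ w"]) auto
qed

lemma weight_pairs_diagonal:
  assumes "(i, j) \<in> weight_pairs \<Sigma> x y" "(1, 1) \<in> weight_pairs \<Sigma> x y"
  shows "(i + k, j + k) \<in> weight_pairs \<Sigma> x y"
  by (induction k) (use assms weight_pairs_add[OF _ assms(2)] in auto)

text \<open>Going down the diagonal from a point of the rectangle ends on an edge where one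
  coordinate is 1. Hence the two edges generate the whole rectangle, using the common corner (1, 1)
  as the diagonal step.\<close>

lemma weight_pairs_rectangle:
  assumes X: "\<And>i. i \<in> {1..a} \<Longrightarrow> (i, 1) \<in> weight_pairs \<Sigma> x y"
    and Y: "\<And>j. j \<in> {1..b} \<Longrightarrow> (1, j) \<in> weight_pairs \<Sigma> x y"
    and "i \<in> {1..a}" "j \<in> {1..b}"
  shows "(i, j) \<in> weight_pairs \<Sigma> x y"
proof (cases "i \<le> j")
  case True
  then have "(1, j - i + 1) \<in> weight_pairs \<Sigma> x y"
    using assms(3,4) by (intro Y) auto
  from weight_pairs_diagonal[OF this, of "i - 1"] show ?thesis
    using True assms(3,4) X[of 1] by auto
next
  case False
  then have "(i - j + 1, 1) \<in> weight_pairs \<Sigma> x y"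
    using assms(3,4) by (intro X) auto
  from weight_pairs_diagonal[OF this, of "j - 1"] show ?thesis
    using False assms(3,4) X[of 1] by auto
qed

text \<open>The pair (1, 1) serves both families, which saves one letter.\<close>

lemma obtain_weights:
  assumes "finite \<Sigma>" "finite X" "finite Y" "1 \<in> X" "1 \<in> Y" "0 \<notin> X" "0 \<notin> Y"
    and card: "card X + card Y - 1 \<le> card \<Sigma>"
  obtains x y :: "'a \<Rightarrow> nat" where "\<And>a. a \<in> \<Sigma> \<Longrightarrow> x a > 0" "\<And>a. a \<in> \<Sigma> \<Longrightarrow> y a > 0"
    "\<And>i. i \<in> X \<Longrightarrow> \<exists>a\<in>\<Sigma>. x a = i \<and> y a = 1" "\<And>j. j \<in> Y \<Longrightarrow> \<exists>a\<in>\<Sigma>. x a = 1 \<and> y a = j"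
proof -
  let ?Z = "{1} \<times> Y \<union> (X - {1}) \<times> {1}"
  have "card ?Z = card Y + (card X - 1)"
    using assms by (subst card_Un_disjoint) (auto simp: card_cartesian_product)
  moreover have "card X \<ge> 1"
    using assms by (metis One_nat_def Suc_leI card_gt_0_iff empty_iff)
  ultimately have "card ?Z \<le> card \<Sigma>"
    using card by simp
  then obtain g where "inj_on g ?Z" "g ` ?Z \<subseteq> \<Sigma>"
    using card_le_inj[of ?Z \<Sigma>] assms by auto
  \<comment> \<open>A surjection from the alphabet lets surplus letters repeat weights already in
    use, so they stay positive.\<close>
  then obtain h where h: "h ` \<Sigma> = ?Z"
    using inj_on_iff_surj[of ?Z \<Sigma>] assms by auto
  have mem: "(fst (h a), snd (h a)) \<in> ?Z" if "a \<in> \<Sigma>" for a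
    using h that by (metis imageI prod.collapse)
  have surj: "\<exists>a\<in>\<Sigma>. fst (h a) = i \<and> snd (h a) = j" if "(i, j) \<in> ?Z" for i j
    using h that by (metis imageE fst_conv snd_conv)
  have zero: "i \<noteq> 0 \<and> j \<noteq> 0" if "(i, j) \<in> ?Z" for i j
    using that assms by (metis Un_iff mem_Sigma_iff DiffD1 singletonD zero_neq_one)
  show ?thesis
  proof (rule that[of "fst \<circ> h" "snd \<circ> h"])
    show "(fst \<circ> h) a > 0" "(snd \<circ> h) a > 0" if "a \<in> \<Sigma>" for a
      using zero[OF mem[OF that]] by simp_all
    show "\<exists>a\<in>\<Sigma>. (fst \<circ> h) a = i \<and> (snd \<circ> h) a = 1" if "i \<in> X" for i
      using surj[of i 1] that assms by auto
    show "\<exists>a\<in>\<Sigma>. (fst \<circ> h) a = 1 \<and> (snd \<circ> h) a = j" if "j \<in> Y" for j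
      using surj[of 1 j] that by auto
  qed
qed

text \<open>
  For \<open>i = j = 0\<close> this is a Boolean combination of two weight languages; for the weights
  \<open>(i, j)\<close> of a word it is the quotient of that combination by the word.
\<close>
definition weight_combination ::
  "'a set \<Rightarrow> ('a \<Rightarrow> nat) \<Rightarrow> ('a \<Rightarrow> nat) \<Rightarrow> (bool \<Rightarrow> bool \<Rightarrow> bool) \<Rightarrow> nat \<Rightarrow> nat \<Rightarrow> nat \<times> nat \<Rightarrow> 'a list set"
where
  "weight_combination \<Sigma> x y B M N =
    (\<lambda>(i, j). {v \<in> lists \<Sigma>. B (weight x v + i = M) (weight y v + j = N)})"

lemma quotients_weight_combination:
  "quotients \<Sigma> (weight_combination \<Sigma> x y B M N (0, 0)) =
    weight_combination \<Sigma> x y B M N ` weight_pairs \<Sigma> x y"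
proof -
  have "left_quotient \<Sigma> (weight_combination \<Sigma> x y B M N (0, 0)) w =
      weight_combination \<Sigma> x y B M N (weight x w, weight y w)" if "w \<in> lists \<Sigma>" for w
    using that by (auto simp: left_quotient_def weight_combination_def add.commute)
  then show ?thesis
    by (simp add: quotients_def weight_pairs_def image_image)
qed

lemma card_le_quotient_complexity:
  assumes P: "P \<subseteq> weight_pairs \<Sigma> x y" and inj: "inj_on (weight_combination \<Sigma> x y B M N) P"
  shows "card P \<le> quotient_complexity \<Sigma> (weight_combination \<Sigma> x y B M N (0, 0))"
proof -
  let ?G = "weight_combination \<Sigma> x y B M N"
  \<comment> \<open>Capping the weights shows that there are finitely many quotients. This matters
    because \<open>card\<close> of an infinite set is 0, which would defeat
    \<open>card_mono\<close>.\<close>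
  have "?G (i, j) = ?G (min i (M + 1), min j (N + 1))" for i j
  proof -
    have "(weight x v + i = M) = (weight x v + min i (M + 1) = M)"
      "(weight y v + j = N) = (weight y v + min j (N + 1) = N)" for v
      by auto
    then show ?thesis by (simp add: weight_combination_def)
  qed
  then have "?G (i, j) \<in> ?G ` ({..M + 1} \<times> {..N + 1})" for i j
    by (rule image_eqI) simp
  then have "range ?G \<subseteq> ?G ` ({..M + 1} \<times> {..N + 1})"
    by (metis image_subsetI surj_pair)
  then have "finite (?G ` weight_pairs \<Sigma> x y)"
    by (meson finite_SigmaI finite_atMost finite_imageI finite_subset image_mono subset_UNIV)
  then have "card (?G ` P) \<le> card (?G ` weight_pairs \<Sigma> x y)"
    using P by (intro card_mono image_mono)
  then show ?thesis
    using card_image[OF inj] by (simp add: quotient_complexity_eq_card quotients_weight_combination)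
qed

text \<open>A word with weights \<open>(p, q)\<close> acts as a test: equal quotients must agree on
  it. All injectivity proofs below choose suitable tests.\<close>

lemma weight_combination_eq_imp:
  assumes "weight_combination \<Sigma> x y B M N (i, j) = weight_combination \<Sigma> x y B M N (i', j')"
    and "(p, q) \<in> weight_pairs \<Sigma> x y"
  shows "B (p + i = M) (q + j = N) = B (p + i' = M) (q + j' = N)"
proof -
  obtain w where "w \<in> lists \<Sigma>" "p = weight x w" "q = weight y w"
    using assms(2) by (auto simp: weight_pairs_def)
  then show ?thesis
    using assms(1) by (auto simp: weight_combination_def set_eq_iff)
qed

section \<open>Witnesses\<close>

text \<open>The value \<open>B True True\<close> is left open, so that both union and symmetric
  difference are covered.\<close>

lemma union_like_lower_bound:
  assumes M: "M \<ge> 2" and N: "N \<ge> 2"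
    and X: "\<And>i. i \<in> {1..M + 1} \<Longrightarrow> (i, 1) \<in> weight_pairs \<Sigma> x y"
    and Y: "\<And>j. j \<in> {1..N + 1} \<Longrightarrow> (1, j) \<in> weight_pairs \<Sigma> x y"
    and B: "B True False" "B False True" "\<not> B False False"
  shows "(M + 1) * (N + 1) - 1 \<le> quotient_complexity \<Sigma> (weight_combination \<Sigma> x y B M N (0, 0))"
proof -
  note eqD = weight_combination_eq_imp[of \<Sigma> x y B M N]
  note rect = weight_pairs_rectangle[of "M + 1" \<Sigma> x y "N + 1", OF X Y]
  \<comment> \<open>For positive weights, \<open>(M + 1, N)\<close> and
    \<open>(M + 1, N + 1)\<close> already give \<open>{[]}\<close> and \<open>{}\<close>. The points
    \<open>(M, N)\<close> and \<open>(M, N + 1)\<close> would only repeat these and are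
    removed.\<close>
  let ?D = "{1..M + 1} \<times> {1..N + 1} - {M} \<times> {N, N + 1}"
  let ?P = "insert (0, 0) ?D"
  have "card ?D = (M + 1) * (N + 1) - 2"
    using M N by (subst card_Diff_subset) (auto simp: card_cartesian_product)
  moreover have "(M + 1) * (N + 1) \<ge> 2"
    using M by simp
  ultimately have cardP: "card ?P = (M + 1) * (N + 1) - 1"
    by (subst card_insert_disjoint) auto
  have sub: "?P \<subseteq> weight_pairs \<Sigma> x y"
    using rect weight_pairs_zero by auto
  have inj: "inj_on (weight_combination \<Sigma> x y B M N) ?P"
  proof (rule inj_onI, clarify)
    fix i j i' j' :: nat
    assume P: "(i, j) \<in> ?P" "(i', j') \<in> ?P"
      and eq: "weight_combination \<Sigma> x y B M N (i, j) = weight_combination \<Sigma> x y B M N (i', j')"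
    have B_imp: "u \<or> v" if "B u v" for u v
      using that B(3) by (cases u; cases v) auto
    \<comment> \<open>The test has second weight \<open>N + 1\<close>, which overshoots
      \<open>N\<close> for both points, so its outcome depends on the first coordinates
      alone.\<close>
    have fst: "i = i'" if "i < M \<or> i' < M"
    proof -
      define p where "p = (if i < M then M - i else M - i')"
      have "(p, N + 1) \<in> weight_pairs \<Sigma> x y"
        using that M by (intro rect) (auto simp: p_def)
      from eqD[OF eq this] show ?thesis
        using that B B_imp[of "p + i = M" False] B_imp[of "p + i' = M" False]
        by (auto simp: p_def split: if_splits)
    qed
    have snd: "j = j'" if "j < N \<or> j' < N"
    proof -
      define q where "q = (if j < N then N - j else N - j')"
      have "(M + 1, q) \<in> weight_pairs \<Sigma> x y"
        using that N by (intro rect) (auto simp: q_def)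
      from eqD[OF eq this] show ?thesis
        using that B B_imp[of False "q + j = N"] B_imp[of False "q + j' = N"]
        by (auto simp: q_def split: if_splits)
    qed
    \<comment> \<open>What remains is to separate \<open>M\<close> from \<open>M + 1\<close> and
      \<open>N\<close> from \<open>N + 1\<close>; the empty word does this.\<close>
    have zero: "B (i = M) (j = N) = B (i' = M) (j' = N)"
      using eqD[OF eq weight_pairs_zero] by simp
    have i: "i = i'"
    proof (rule ccontr)
      assume "i \<noteq> i'"
      moreover from this have "\<not> i < M" "\<not> i' < M"
        using fst by auto
      ultimately have "i = M \<and> j < N \<and> i' = M + 1 \<or> i = M + 1 \<and> i' = M \<and> j' < N"
        using P M by auto
      then show False
        using snd zero B by auto
    qed
    have "j = j'"
    proof (rule ccontr)
      assume "j \<noteq> j'"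
      moreover from this have "\<not> j < N" "\<not> j' < N"
        using snd by auto
      ultimately have "i \<noteq> M \<and> (j = N \<and> j' = N + 1 \<or> j = N + 1 \<and> j' = N)"
        using P N i by auto
      then show False
        using i zero B by auto
    qed
    with i show "i = i' \<and> j = j'" by simp
  qed
  show ?thesis
    using card_le_quotient_complexity[OF sub inj] unfolding cardP .
qed

lemma intersection_lower_bound:
  assumes M: "M \<ge> 2" and N: "N \<ge> 2"
    and X: "\<And>i. i \<in> {1..M - 1} \<Longrightarrow> (i, 1) \<in> weight_pairs \<Sigma> x y"
    and Y: "\<And>j. j \<in> {1..N - 1} \<Longrightarrow> (1, j) \<in> weight_pairs \<Sigma> x y"
  shows "(M - 1) * (N - 1) + 3 \<le> quotient_complexity \<Sigma> (weight_combination \<Sigma> x y (\<and>) M N (0, 0))"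
proof -
  note eqD = weight_combination_eq_imp[of \<Sigma> x y "(\<and>)" M N]
  note rect = weight_pairs_rectangle[of "M - 1" \<Sigma> x y "N - 1", OF X Y]
  let ?D = "{1..M - 1} \<times> {1..N - 1}"
  \<comment> \<open>The three extra points stand for the initial quotient, \<open>{[]}\<close> and
    \<open>{}\<close>.\<close>
  let ?P = "{(0, 0), (M, N), (M + 1, N + 1)} \<union> ?D"
  have one: "(1, 1) \<in> weight_pairs \<Sigma> x y"
    using X[of 1] M by simp
  have MN: "(M, N) \<in> weight_pairs \<Sigma> x y"
    using weight_pairs_add[OF rect[of "M - 1" "N - 1"] one] M N by simp
  have cardP: "card ?P = (M - 1) * (N - 1) + 3"
    using M N by (subst card_Un_disjoint) (auto simp: card_cartesian_product)
  have sub: "?P \<subseteq> weight_pairs \<Sigma> x y"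
    using rect weight_pairs_zero MN weight_pairs_add[OF MN one] by auto
  have inj: "inj_on (weight_combination \<Sigma> x y (\<and>) M N) ?P"
  proof (rule inj_onI, clarify)
    fix i j i' j' :: nat
    assume P: "(i, j) \<in> ?P" "(i', j') \<in> ?P"
      and eq: "weight_combination \<Sigma> x y (\<and>) M N (i, j) = weight_combination \<Sigma> x y (\<and>) M N (i', j')"
    \<comment> \<open>The complementary weights complete \<open>(i, j)\<close> to
      \<open>(M, N)\<close> and complete no other point to it. At \<open>(M + 1, N + 1)\<close>
      subtraction truncates to (0, 0) and the test says nothing, but two distinct points cannot both
      be that one.\<close>
    have "(M - i, N - j) \<in> weight_pairs \<Sigma> x y" if "(i, j) \<in> ?P" for i j
    proof (cases "(i, j) \<in> ?D")
      case True
      then show ?thesis by (intro rect) auto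
    next
      case False
      then show ?thesis using that MN weight_pairs_zero by auto
    qed
    note eqs = eqD[OF eq this[OF P(1)]] eqD[OF eq this[OF P(2)]]
    have "i \<le> M \<and> j \<le> N \<or> i = M + 1 \<and> j = N + 1" "i' \<le> M \<and> j' \<le> N \<or> i' = M + 1 \<and> j' = N + 1"
      using P by auto
    moreover have "i = i' \<and> j = j'" if "i \<le> M \<and> j \<le> N"
      using eqs(1) that by auto
    moreover have "i = i' \<and> j = j'" if "i' \<le> M \<and> j' \<le> N"
      using eqs(2) that by auto
    ultimately show "i = i' \<and> j = j'" by metis
  qed
  show ?thesis
    using card_le_quotient_complexity[OF sub inj] unfolding cardP .
qed

lemma difference_lower_bound:
  assumes M: "M \<ge> 2" and N: "N \<ge> 2"
    and X: "\<And>i. i \<in> {1..M - 1} \<Longrightarrow> (i, 1) \<in> weight_pairs \<Sigma> x y"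
    and Y: "\<And>j. j \<in> insert (N + 1) {1..N - 1} \<Longrightarrow> (1, j) \<in> weight_pairs \<Sigma> x y"
  shows "(M - 1) * N + 3 \<le> quotient_complexity \<Sigma> (weight_combination \<Sigma> x y (\<lambda>a b. a \<and> \<not> b) M N (0, 0))"
proof -
  let ?G = "weight_combination \<Sigma> x y (\<lambda>a b. a \<and> \<not> b) M N"
  note eqD = weight_combination_eq_imp[of \<Sigma> x y "\<lambda>a b. a \<and> \<not> b" M N]
  have rect: "(i, j) \<in> weight_pairs \<Sigma> x y" if "i \<in> {1..M - 1}" "j \<in> {1..N - 1}" for i j
    using weight_pairs_rectangle[of "M - 1" \<Sigma> x y "N - 1", OF X Y] that by blast
  \<comment> \<open>A letter of weights \<open>(1, N + 1)\<close> takes the second component past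
    \<open>N\<close> at once, and diagonal steps then vary the first one. These points realise the
    pairs whose second quotient is empty.\<close>
  have far: "(i, N + i) \<in> weight_pairs \<Sigma> x y" if "i \<ge> 1" for i
    using weight_pairs_diagonal[OF Y[of "N + 1"] Y[of 1], of "i - 1"] that N by simp
  let ?D = "{1..M - 1} \<times> {1..N - 1}"
  let ?E = "(\<lambda>i. (i, N + i)) ` {1..M + 1}"
  let ?P = "insert (0, 0) (?D \<union> ?E)"
  have "card ?E = M + 1"
    by (subst card_image) (auto intro: inj_onI)
  then have "card (?D \<union> ?E) = (M - 1) * (N - 1) + (M + 1)"
    using M N by (subst card_Un_disjoint) (auto simp: card_cartesian_product)
  then have "card ?P = (M - 1) * (N - 1) + (M + 1) + 1"
    by (subst card_insert_disjoint) auto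
  moreover have "(M - 1) * (N - 1) + (M + 1) + 1 = (M - 1) * N + 3"
    using M N by (cases M; cases N) auto
  ultimately have cardP: "card ?P = (M - 1) * N + 3" by simp
  have sub: "?P \<subseteq> weight_pairs \<Sigma> x y"
    using rect far weight_pairs_zero by auto
  have inj: "inj_on ?G ?P"
  proof (rule inj_onI, clarify)
    fix i j i' j' :: nat
    assume P: "(i, j) \<in> ?P" "(i', j') \<in> ?P" and eq: "?G (i, j) = ?G (i', j')"
    have fst: "i = i'" if "i < M \<or> i' < M"
    proof -
      define p where "p = (if i < M then M - i else M - i')"
      have "(p, N + p) \<in> weight_pairs \<Sigma> x y"
        using that M by (intro far) (auto simp: p_def)
      from eqD[OF eq this] show ?thesis
        using that by (auto simp: p_def split: if_splits)
    qed
    show "i = i' \<and> j = j'"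
    proof (cases "i < M \<or> i' < M")
      case True
      then have i: "i = i'" "i < M"
        using fst by auto
      have "j = j'"
      proof (rule ccontr)
        assume "j \<noteq> j'"
        \<comment> \<open>At least one of \<open>j\<close>, \<open>j'\<close> is below
          \<open>N\<close>, as otherwise both equal \<open>N + i\<close>. The test
          \<open>(M - i, q)\<close> completes the first weight to \<open>M\<close> and exactly one
          of the second weights to \<open>N\<close>, so it lies in just one of the two
          quotients.\<close>
        define q where "q = (if j < N then N - j else N - j')"
        have "(M - i, q) \<in> weight_pairs \<Sigma> x y"
          using P i N \<open>j \<noteq> j'\<close> by (intro rect) (auto simp: q_def)
        from eqD[OF eq this] show False
          using P i N \<open>j \<noteq> j'\<close> by (auto simp: q_def split: if_splits)
      qed
      with i show ?thesis by simp
    next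
      case False
      then have "i \<in> {M, M + 1}" "j = N + i" "i' \<in> {M, M + 1}" "j' = N + i'"
        using P M by auto
      then show ?thesis
        using eqD[OF eq weight_pairs_zero] M by auto
    qed
  qed
  show ?thesis
    using card_le_quotient_complexity[OF sub inj] unfolding cardP .
qed

section \<open>Languages that attain the bounds\<close>

lemma obtain_weight_languages:
  assumes "finite \<Sigma>" "finite X" "finite Y" "1 \<in> X" "1 \<in> Y" "0 \<notin> X" "0 \<notin> Y"
    and "card X + card Y - 1 \<le> card \<Sigma>"
  obtains x y :: "'a \<Rightarrow> nat" where
    "\<And>M. weight_language \<Sigma> x M \<in> subword_free_languages \<Sigma> (M + 2)"
    "\<And>N. weight_language \<Sigma> y N \<in> subword_free_languages \<Sigma> (N + 2)"
    "\<And>i. i \<in> X \<Longrightarrow> (i, 1) \<in> weight_pairs \<Sigma> x y" "\<And>j. j \<in> Y \<Longrightarrow> (1, j) \<in> weight_pairs \<Sigma> x y"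
proof -
  obtain x y where pos: "\<And>a. a \<in> \<Sigma> \<Longrightarrow> x a > 0" "\<And>a. a \<in> \<Sigma> \<Longrightarrow> y a > 0"
    and X: "\<And>i. i \<in> X \<Longrightarrow> \<exists>a\<in>\<Sigma>. x a = i \<and> y a = 1"
    and Y: "\<And>j. j \<in> Y \<Longrightarrow> \<exists>a\<in>\<Sigma>. x a = 1 \<and> y a = j"
    using obtain_weights[OF assms] by blast
  \<comment> \<open>This single letter supplies the weight 1 that each of the two languages
    needs.\<close>
  obtain a where "a \<in> \<Sigma>" "x a = 1" "y a = 1"
    using X[OF assms(4)] by blast
  then show ?thesis
    using weight_language_subword_free_languages[of \<Sigma> x a, OF pos(1)]
      weight_language_subword_free_languages[of \<Sigma> y a, OF pos(2)] X Y weight_pairs_letter[of _ \<Sigma> x y]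
    by (intro that[of x y]) metis+
qed

lemma union_like_witness:
  assumes m: "m \<ge> 4" and n: "n \<ge> 4" and fin: "finite \<Sigma>" and card: "m + n - 3 \<le> card \<Sigma>"
    and f: "\<And>K L w. w \<in> f K L \<longleftrightarrow> B (w \<in> K) (w \<in> L)"
    and B: "B True False" "B False True" "\<not> B False False"
    and bound: "\<And>K L. \<lbrakk>K \<in> subword_free_languages \<Sigma> m; L \<in> subword_free_languages \<Sigma> n\<rbrakk>
      \<Longrightarrow> quotient_complexity \<Sigma> (f K L) \<le> m * n - (m + n)"
  shows "\<exists>K\<in>subword_free_languages \<Sigma> m. \<exists>L\<in>subword_free_languages \<Sigma> n.
    quotient_complexity \<Sigma> (f K L) = m * n - (m + n)"
proof -
  \<comment> \<open>A weight language for \<open>M\<close> has \<open>M + 2\<close> quotients. The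
    edges used below have \<open>M + 1\<close> and \<open>N + 1\<close> points with one in common,
    which makes \<open>m + n - 3\<close> letters.\<close>
  define M N where "M = m - 2" and "N = n - 2"
  with m n have MN: "m = M + 2" "n = N + 2" "M \<ge> 2" "N \<ge> 2" by auto
  obtain x y :: "'a \<Rightarrow> nat" where
    x: "\<And>M. weight_language \<Sigma> x M \<in> subword_free_languages \<Sigma> (M + 2)"
    and y: "\<And>N. weight_language \<Sigma> y N \<in> subword_free_languages \<Sigma> (N + 2)"
    and pairs: "\<And>i. i \<in> {1..M + 1} \<Longrightarrow> (i, 1) \<in> weight_pairs \<Sigma> x y"
      "\<And>j. j \<in> {1..N + 1} \<Longrightarrow> (1, j) \<in> weight_pairs \<Sigma> x y"
    by (rule obtain_weight_languages[of \<Sigma> "{1..M + 1}" "{1..N + 1}"]) (use fin card MN in auto)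
  let ?K = "weight_language \<Sigma> x M" and ?L = "weight_language \<Sigma> y N"
  \<comment> \<open>Words outside \<open>lists \<Sigma>\<close> belong to neither language, and
    \<open>\<not> B False False\<close> keeps them out of \<open>f ?K ?L\<close>.\<close>
  have "f ?K ?L = weight_combination \<Sigma> x y B M N (0, 0)"
  proof (rule set_eqI)
    fix v
    show "v \<in> f ?K ?L \<longleftrightarrow> v \<in> weight_combination \<Sigma> x y B M N (0, 0)"
      unfolding f using B(3) by (cases "v \<in> lists \<Sigma>") (simp_all add: weight_language_def weight_combination_def)
  qed
  then have "(M + 1) * (N + 1) - 1 \<le> quotient_complexity \<Sigma> (f ?K ?L)"
    using union_like_lower_bound[where B = B, OF MN(3,4) pairs B] by simp
  moreover have "(M + 1) * (N + 1) - 1 = m * n - (m + n)"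
    using MN by (simp add: algebra_simps)
  ultimately show ?thesis
    using bound x[of M] y[of N] MN by (metis le_antisym)
qed

lemma intersection_witness:
  assumes m: "m \<ge> 4" and n: "n \<ge> 4" and fin: "finite \<Sigma>" and card: "m + n - 7 \<le> card \<Sigma>"
  shows "\<exists>K\<in>subword_free_languages \<Sigma> m. \<exists>L\<in>subword_free_languages \<Sigma> n.
    quotient_complexity \<Sigma> (K \<inter> L) = m * n - 3 * (m + n - 4)"
proof -
  define M N where "M = m - 2" and "N = n - 2"
  with m n have MN: "m = M + 2" "n = N + 2" "M \<ge> 2" "N \<ge> 2" by auto
  obtain x y :: "'a \<Rightarrow> nat" where
    x: "\<And>M. weight_language \<Sigma> x M \<in> subword_free_languages \<Sigma> (M + 2)"
    and y: "\<And>N. weight_language \<Sigma> y N \<in> subword_free_languages \<Sigma> (N + 2)"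
    and pairs: "\<And>i. i \<in> {1..M - 1} \<Longrightarrow> (i, 1) \<in> weight_pairs \<Sigma> x y"
      "\<And>j. j \<in> {1..N - 1} \<Longrightarrow> (1, j) \<in> weight_pairs \<Sigma> x y"
    by (rule obtain_weight_languages[of \<Sigma> "{1..M - 1}" "{1..N - 1}"]) (use fin card MN in auto)
  let ?K = "weight_language \<Sigma> x M" and ?L = "weight_language \<Sigma> y N"
  have "?K \<inter> ?L = weight_combination \<Sigma> x y (\<and>) M N (0, 0)"
    by (auto simp: weight_language_def weight_combination_def)
  then have "(M - 1) * (N - 1) + 3 \<le> quotient_complexity \<Sigma> (?K \<inter> ?L)"
    using intersection_lower_bound[OF MN(3,4) pairs] by simp
  moreover have "(M - 1) * (N - 1) + 3 = m * n - 3 * (m + n - 4)"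
    using MN by (cases M; cases N) (auto simp: algebra_simps)
  ultimately show ?thesis
    using intersection_bound(1)[OF _ m _ n fin] x[of M] y[of N] MN by (metis le_antisym)
qed

lemma difference_witness:
  assumes m: "m \<ge> 4" and n: "n \<ge> 4" and fin: "finite \<Sigma>" and card: "m + n - 6 \<le> card \<Sigma>"
  shows "\<exists>K\<in>subword_free_languages \<Sigma> m. \<exists>L\<in>subword_free_languages \<Sigma> n.
    quotient_complexity \<Sigma> (K - L) = m * n - (2 * m + 3 * n - 9)"
proof -
  define M N where "M = m - 2" and "N = n - 2"
  with m n have MN: "m = M + 2" "n = N + 2" "M \<ge> 2" "N \<ge> 2" by auto
  obtain x y :: "'a \<Rightarrow> nat" where
    x: "\<And>M. weight_language \<Sigma> x M \<in> subword_free_languages \<Sigma> (M + 2)"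
    and y: "\<And>N. weight_language \<Sigma> y N \<in> subword_free_languages \<Sigma> (N + 2)"
    and pairs: "\<And>i. i \<in> {1..M - 1} \<Longrightarrow> (i, 1) \<in> weight_pairs \<Sigma> x y"
      "\<And>j. j \<in> insert (N + 1) {1..N - 1} \<Longrightarrow> (1, j) \<in> weight_pairs \<Sigma> x y"
    \<comment> \<open>The second edge skips \<open>N\<close> but includes \<open>N + 1\<close>, so
      it has \<open>N\<close> points; with the \<open>M - 1\<close> points of the first edge this
      makes \<open>m + n - 6\<close> letters.\<close>
    by (rule obtain_weight_languages[of \<Sigma> "{1..M - 1}" "insert (N + 1) {1..N - 1}"])
      (use fin card MN in auto)
  let ?K = "weight_language \<Sigma> x M" and ?L = "weight_language \<Sigma> y N"
  have "?K - ?L = weight_combination \<Sigma> x y (\<lambda>a b. a \<and> \<not> b) M N (0, 0)"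
    by (auto simp: weight_language_def weight_combination_def)
  then have "(M - 1) * N + 3 \<le> quotient_complexity \<Sigma> (?K - ?L)"
    using difference_lower_bound[OF MN(3,4) pairs] by simp
  moreover have "(M - 1) * N + 3 = m * n - (2 * m + 3 * n - 9)"
    using MN by (cases M; cases N) (auto simp: algebra_simps)
  ultimately show ?thesis
    using difference_bound(1)[OF _ m _ n fin] x[of M] y[of N] MN by (metis le_antisym)
qed

theorem theorem2:
  fixes m n :: nat and \<Sigma> :: "'a set"
  assumes "m \<ge> 4" and "n \<ge> 4" and "finite \<Sigma>" and "\<Sigma> \<noteq> {}"
  shows "
     ((\<forall>K \<in> subword_free_languages \<Sigma> m. \<forall>L \<in> subword_free_languages \<Sigma> n.
           quotient_complexity \<Sigma> (K \<union> L) \<le> m * n - (m + n)) \<and>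
      (card \<Sigma> \<ge> m + n - 3 \<longrightarrow>
        (\<exists>K \<in> subword_free_languages \<Sigma> m. \<exists>L \<in> subword_free_languages \<Sigma> n.
           quotient_complexity \<Sigma> (K \<union> L) = m * n - (m + n))) \<and>
      (card \<Sigma> < m + n - 3 \<longrightarrow>
        \<not> (\<exists>K \<in> subword_free_languages \<Sigma> m. \<exists>L \<in> subword_free_languages \<Sigma> n.
           quotient_complexity \<Sigma> (K \<union> L) = m * n - (m + n)))) \<and>
     ((\<forall>K \<in> subword_free_languages \<Sigma> m. \<forall>L \<in> subword_free_languages \<Sigma> n.
           quotient_complexity \<Sigma> (sym_diff K L) \<le> m * n - (m + n)) \<and>
      (card \<Sigma> \<ge> m + n - 3 \<longrightarrow>
        (\<exists>K \<in> subword_free_languages \<Sigma> m. \<exists>L \<in> subword_free_languages \<Sigma> n.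
           quotient_complexity \<Sigma> (sym_diff K L) = m * n - (m + n))) \<and>
      (card \<Sigma> < m + n - 3 \<longrightarrow>
        \<not> (\<exists>K \<in> subword_free_languages \<Sigma> m. \<exists>L \<in> subword_free_languages \<Sigma> n.
           quotient_complexity \<Sigma> (sym_diff K L) = m * n - (m + n)))) \<and>
     ((\<forall>K \<in> subword_free_languages \<Sigma> m. \<forall>L \<in> subword_free_languages \<Sigma> n.
           quotient_complexity \<Sigma> (K \<inter> L) \<le> m * n - 3 * (m + n - 4)) \<and>
      (card \<Sigma> \<ge> m + n - 7 \<longrightarrow>
        (\<exists>K \<in> subword_free_languages \<Sigma> m. \<exists>L \<in> subword_free_languages \<Sigma> n.
           quotient_complexity \<Sigma> (K \<inter> L) = m * n - 3 * (m + n - 4))) \<and>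
      (card \<Sigma> < m + n - 7 \<longrightarrow>
        \<not> (\<exists>K \<in> subword_free_languages \<Sigma> m. \<exists>L \<in> subword_free_languages \<Sigma> n.
           quotient_complexity \<Sigma> (K \<inter> L) = m * n - 3 * (m + n - 4)))) \<and>
     ((\<forall>K \<in> subword_free_languages \<Sigma> m. \<forall>L \<in> subword_free_languages \<Sigma> n.
           quotient_complexity \<Sigma> (K - L) \<le> m * n - (2 * m + 3 * n - 9)) \<and>
      (card \<Sigma> \<ge> m + n - 6 \<longrightarrow>
        (\<exists>K \<in> subword_free_languages \<Sigma> m. \<exists>L \<in> subword_free_languages \<Sigma> n.
           quotient_complexity \<Sigma> (K - L) = m * n - (2 * m + 3 * n - 9))) \<and>
      (card \<Sigma> < m + n - 6 \<longrightarrow>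
        \<not> (\<exists>K \<in> subword_free_languages \<Sigma> m. \<exists>L \<in> subword_free_languages \<Sigma> n.
           quotient_complexity \<Sigma> (K - L) = m * n - (2 * m + 3 * n - 9))))"
proof -
  let ?S = "subword_free_languages \<Sigma>"
  have sym: "left_quotient \<Sigma> (sym_diff K L) w = sym_diff (left_quotient \<Sigma> K w) (left_quotient \<Sigma> L w)"
    for K L :: "'a list set" and w
    by (simp add: left_quotient_boolean)
  have un: "quotient_complexity \<Sigma> (K \<union> L) \<le> m * n - (m + n)"
    "quotient_complexity \<Sigma> (K \<union> L) = m * n - (m + n) \<Longrightarrow> m + n - 3 \<le> card \<Sigma>"
    if "K \<in> ?S m" "L \<in> ?S n" for K L
    using union_like_bound[where f = "(\<union>)", OF that(1) assms(1) that(2) assms(2,3) left_quotient_boolean(1)]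
    by auto
  have sd: "quotient_complexity \<Sigma> (sym_diff K L) \<le> m * n - (m + n)"
    "quotient_complexity \<Sigma> (sym_diff K L) = m * n - (m + n) \<Longrightarrow> m + n - 3 \<le> card \<Sigma>"
    if "K \<in> ?S m" "L \<in> ?S n" for K L
    using union_like_bound[where f = sym_diff, OF that(1) assms(1) that(2) assms(2,3) sym] by auto
  note int = intersection_bound[OF _ assms(1) _ assms(2,3)]
  note diff = difference_bound[OF _ assms(1) _ assms(2,3)]
  \<comment> \<open>The claim about smaller alphabets is the contrapositive of the second
    premise.\<close>
  have tight: "(\<forall>K\<in>?S m. \<forall>L\<in>?S n. quotient_complexity \<Sigma> (f K L) \<le> b) \<and>
      (s \<le> card \<Sigma> \<longrightarrow> (\<exists>K\<in>?S m. \<exists>L\<in>?S n. quotient_complexity \<Sigma> (f K L) = b)) \<and>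
      (card \<Sigma> < s \<longrightarrow> \<not> (\<exists>K\<in>?S m. \<exists>L\<in>?S n. quotient_complexity \<Sigma> (f K L) = b))"
    if "\<And>K L. K \<in> ?S m \<Longrightarrow> L \<in> ?S n \<Longrightarrow> quotient_complexity \<Sigma> (f K L) \<le> b"
      and "\<And>K L. K \<in> ?S m \<Longrightarrow> L \<in> ?S n \<Longrightarrow> quotient_complexity \<Sigma> (f K L) = b \<Longrightarrow> s \<le> card \<Sigma>"
      and "s \<le> card \<Sigma> \<Longrightarrow> \<exists>K\<in>?S m. \<exists>L\<in>?S n. quotient_complexity \<Sigma> (f K L) = b"
    for f b s
    using that by (metis leD)
  have un_wit: "\<exists>K\<in>?S m. \<exists>L\<in>?S n. quotient_complexity \<Sigma> (K \<union> L) = m * n - (m + n)"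
    if "m + n - 3 \<le> card \<Sigma>"
    by (rule union_like_witness[where B = "(\<or>)", OF assms(1-3) that]) (use un(1) in auto)
  have sd_wit: "\<exists>K\<in>?S m. \<exists>L\<in>?S n. quotient_complexity \<Sigma> (sym_diff K L) = m * n - (m + n)"
    if "m + n - 3 \<le> card \<Sigma>"
    by (rule union_like_witness[where B = "(\<noteq>)", OF assms(1-3) that]) (use sd(1) in auto)
  show ?thesis
    by (rule conjI[OF tight[OF un un_wit] conjI[OF tight[OF sd sd_wit]
      conjI[OF tight[OF int intersection_witness[OF assms(1-3)]]
        tight[OF diff difference_witness[OF assms(1-3)]]]]])
qed

end
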